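(* Suppose $A$ and $B$ are finite sets of real numbers and let $\Delta(A\times A, B\times B)$ be the set of distances between points in $A\times A$ and points in $B\times B$. Then $$\min\left\{|A-A|,\ |B-B|,\ |A-B|\right\} \ll |\Delta(A\times A, B\times B)|^{1-\frac{13}{205}}\cdot L(A,B),$$ where $$L(A,B)=\min\left\{\log^{\frac{3}{205}}|A|,\ \log^{\frac{3}{205}}|B|\right\}.$$
   Context: For finite sets $X,Y\subset\mathbb{R}$: $|X|$ is the cardinality, $X-Y=\{x-y: x\in X,\ y\in Y\}$, $X+Y=\{x+y: x\in X,\ y\in Y\}$, and $X^2=\{x^2: x\in X\}$ is the set of squares of elements of $X$ (not the product set). $\log^{c} n$ means $(\log n)^{c}$. The notation $\ll$ is the usual Vinogradov symbol: $U\ll V$ means $U\le C\,V$ for some absolute constant $C>0$ (here independent of $A$ and $B$). Distances are recorded by their squares, so that $$\Delta(A\times A,B\times B)=\{(a_1-b_1)^2+(a_2-b_2)^2 : a_1,a_2\in A,\ b_1,b_2\in B\}=(A-B)^2+(A-B)^2;$$ using distances instead of squared distances gives a set of the same cardinality.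
   Formalization: Both A and B are assumed to have at least two elements: if one is a singleton and the other is nonempty, then L(A,B)=0 while the left side is at least 1, so the printed bound fails, and for an empty set the logarithm is undefined. *)

theory Defs
  imports Complex_Main "HOL-Analysis.Product_Vector"
begin

definition diff_set :: "real set \<Rightarrow> real set \<Rightarrow> real set" where
  "diff_set X Y = {x - y | x y. x \<in> X \<and> y \<in> Y}"

(* Distances are recorded by their squares. *)
definition dist_set :: "(real \<times> real) set \<Rightarrow> (real \<times> real) set \<Rightarrow> real set" where
  "dist_set P Q = {(a1 - b1)\<^sup>2 + (a2 - b2)\<^sup>2 | a1 a2 b1 b2. (a1, a2) \<in> P \<and> (b1, b2) \<in> Q}"

lemma dist_set_eq_dist: "dist_set P Q = {(dist p q)\<^sup>2 | p q. p \<in> P \<and> q \<in> Q}"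
  by (fastforce simp: dist_set_def dist_Pair_Pair dist_real_def)

(* Meaningful for sets with at least two elements: ln 1 = 0, so L_factor is 0 if A or B is a
   singleton. *)
definition L_factor :: "real set \<Rightarrow> real set \<Rightarrow> real" where
  "L_factor A B = min (ln (real (card A)) powr (3 / 205)) (ln (real (card B)) powr (3 / 205))"

end

theory Submission
  imports Defs "HOL-Library.Set_Algebras"
begin

text \<open>
  Write \<open>Q = (A - B)\<^sup>2\<close>, so that the set of squared distances is the sumset \<open>\<Delta> = Q + Q\<close>, and let
  \<open>N\<close> be the minimum on the left-hand side. The proof plays two facts against each other.

  First, the parallelogram-type identity
  \<open>2 (a - a') (b - b') = (a - b')\<^sup>2 + (a' - b)\<^sup>2 - (a - b)\<^sup>2 - (a' - b')\<^sup>2\<close>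
  shows that \<open>2 (A - A) (B - B)\<close> lies in \<open>Q + Q - Q - Q\<close>. Hence \<open>3Q - 2Q\<close> contains all numbers
  \<open>q + 2 x y\<close> with \<open>q \<in> Q\<close>, \<open>x \<in> A - A\<close>, \<open>y \<in> B - B\<close>. Here each of the three variables ranges over
  a set of size at least about \<open>N\<close>, and a set of this form is large: it has at
  least of the order of \<open>(N N |Q|)\<^bsup>1/2\<^esup>\<close> elements (lemma \<open>card_sum_prod_lower_bound\<close>). This can be
  read off the Szemeredi--Trotter theorem, but it follows more simply from the fact that each line
  \<open>t \<mapsto> q + x t\<close> is monotone.

  Second, if \<open>Q + Q\<close> is small then so is \<open>3Q - 2Q\<close>: the Pluennecke--Ruzsa inequality (lemma
  \<open>Pluennecke_Ruzsa\<close>, by Petridis' argument) gives \<open>|3Q - 2Q| |Q|\<^sup>4 \<le> |\<Delta>|\<^sup>5\<close>.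

  Together with \<open>|Q| \<ge> N / 2\<close> these yield \<open>N\<^sup>1\<^sup>1 \<le> 2\<^sup>1\<^sup>4 |\<Delta>|\<^sup>1\<^sup>0\<close>. The resulting exponent
  \<open>10/11\<close> is smaller than \<open>1 - 13/205 = 192/205\<close>, and the logarithmic factor is bounded below by a
  positive constant for sets with at least two elements.
\<close>

section \<open>The Pluennecke--Ruzsa inequality\<close>

lemma card_translate: "card ((\<lambda>x. x + c) ` X) = card X"
  for X :: "'a::ab_group_add set"
  by (rule card_image) (simp add: inj_on_def)

text \<open>
  Petridis' lemma. Build up \<open>C\<close> one element at a time. When \<open>c\<close> is added, the part \<open>Z\<close> of \<open>X\<close> for
  which \<open>Z + B + c\<close> was already covered contributes nothing new to \<open>X + B + C\<close>; since \<open>Z\<close> does not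
  grow less than \<open>X\<close> when \<open>B\<close> is added, the loss on the left is at least \<open>K\<close> times the loss on
  the right.
\<close>
lemma Petridis:
  fixes X B C :: "'a::ab_group_add set" and K :: real
  assumes fin: "finite X" "finite B" "finite C"
    and eq: "card (X + B) = K * card X"
    and minimal: "\<And>Z. Z \<subseteq> X \<Longrightarrow> K * card Z \<le> card (Z + B)"
    and K: "K \<ge> 0"
  shows "card (X + B + C) \<le> K * card (X + C)"
  using fin(3)
proof (induction C)
  case empty
  then show ?case by simp
next
  case (insert c C)
  let ?f = "\<lambda>Z. (\<lambda>x. x + c) ` Z"
  define Z where "Z = {x \<in> X. ?f ({x} + B) \<subseteq> X + B + C}"
  have Z: "Z \<subseteq> X" "finite Z"
    using fin by (auto simp: Z_def)
  have ZB: "Z + B \<subseteq> X + B"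
    using Z by (rule_tac set_plus_mono2) auto
  have fins: "finite (X + B)" "finite (X + B + C)" "finite (X + C)" "finite (Z + B)"
    using fin insert Z by (simp_all add: finite_set_plus)
  have "X + B + insert c C \<subseteq> (X + B + C) \<union> ?f ((X + B) - (Z + B))"
  proof
    fix w assume "w \<in> X + B + insert c C"
    then obtain v e where v: "v \<in> X + B" "e \<in> insert c C" "w = v + e"
      by (meson set_plus_elim)
    show "w \<in> (X + B + C) \<union> ?f ((X + B) - (Z + B))"
    proof (cases "e \<in> C \<or> v \<notin> Z + B")
      case True
      then show ?thesis using v by auto
    next
      case False
      then obtain z b where z: "z \<in> Z" "b \<in> B" "v = z + b"
        by (meson set_plus_elim)
      have "w \<in> ?f ({z} + B)"
        using False v z by (auto simp: set_plus_def)
      then show ?thesis using z by (auto simp: Z_def)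
    qed
  qed
  then have "card (X + B + insert c C) \<le> card (X + B + C) + card ((X + B) - (Z + B))"
    by (intro order_trans[OF card_mono order_trans[OF card_Un_le]])
       (auto simp: fins card_translate)
  also have "card ((X + B) - (Z + B)) = card (X + B) - card (Z + B)"
    by (rule card_Diff_subset) (use fins ZB in auto)
  finally have upper:
      "real (card (X + B + insert c C)) \<le> card (X + B + C) + (real (card (X + B)) - card (Z + B))"
    using card_mono[OF fins(1) ZB] by linarith
  have "card ((X + C) \<union> ?f (X - Z)) = card (X + C) + card (?f (X - Z))"
  proof (rule card_Un_disjoint)
    show "(X + C) \<inter> ?f (X - Z) = {}"
    proof (rule ccontr)
      assume "(X + C) \<inter> ?f (X - Z) \<noteq> {}"
      then obtain x y e where x: "x \<in> X - Z" "y \<in> X" "e \<in> C" "x + c = y + e"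
        by (auto simp: set_plus_def)
      \<comment> \<open>\<open>x + c \<in> X + C\<close> forces \<open>x + B + c \<subseteq> X + B + C\<close>, that is, \<open>x \<in> Z\<close>.\<close>
      have "x + b + c \<in> X + B + C" if "b \<in> B" for b
      proof -
        have xbc: "x + b + c = (y + b) + e"
          using x(4) by (metis add.assoc add.commute)
        then show ?thesis
          unfolding xbc by (intro set_plus_intro x(2,3) that)
      qed
      then show False using x by (auto simp: Z_def set_plus_def)
    qed
  qed (use fins fin in auto)
  also have "card (?f (X - Z)) = card X - card Z"
    unfolding card_translate by (rule card_Diff_subset) (use Z in auto)
  finally have lower: "card ((X + C) \<union> ?f (X - Z)) = card (X + C) + (real (card X) - card Z)"
    using card_mono[OF fin(1) Z(1)] by linarith
  have "card ((X + C) \<union> ?f (X - Z)) \<le> card (X + insert c C)"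
    using fin insert by (intro card_mono finite_set_plus Un_least set_plus_mono2) auto
  then have lower': "card (X + C) + (real (card X) - card Z) \<le> card (X + insert c C)"
    using lower by linarith
  have "card (X + B + insert c C) \<le> K * card (X + C) + (K * card X - K * card Z)"
    using upper insert.IH minimal[OF Z(1)] eq by linarith
  also have "\<dots> = K * (card (X + C) + (real (card X) - card Z))"
    by (simp add: algebra_simps)
  also have "\<dots> \<le> K * card (X + insert c C)"
    using lower' K by (rule mult_left_mono)
  finally show ?case .
qed

text \<open>
  Some nonempty subset of \<open>A\<close> has the least growth ratio under addition of \<open>B\<close>; Petridis' lemma
  applies to it, and may be iterated because \<open>C\<close> is arbitrary there.
\<close>
lemma Pluennecke:
  fixes A B :: "'a::ab_group_add set"
  assumes fin: "finite A" "finite B" and ne: "A \<noteq> {}"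
  obtains X where "X \<subseteq> A" "X \<noteq> {}"
    "\<And>k. card (X + (\<Sum>i<k. B)) \<le> (card (A + B) / card A) ^ k * card X"
proof -
  define r where "r Z = card (Z + B) / card Z" for Z
  obtain X where X: "X \<in> Pow A - {{}}" "\<And>Z. Z \<in> Pow A - {{}} \<Longrightarrow> r X \<le> r Z"
    using ex_is_arg_min_if_finite[of "Pow A - {{}}" r] fin(1) ne
    by (auto simp: is_arg_min_linorder)
  have finX: "finite X" and posX: "card X > 0"
    using X(1) fin(1) by (auto intro: finite_subset simp: card_gt_0_iff)
  have r0: "r X \<ge> 0" by (simp add: r_def)
  have eq: "card (X + B) = r X * card X"
    using posX by (simp add: r_def)
  have minimal: "r X * card Z \<le> card (Z + B)" if "Z \<subseteq> X" for Z
  proof (cases "Z = {}")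
    case False
    then have "card Z > 0"
      using that finX by (auto intro: finite_subset simp: card_gt_0_iff)
    moreover have "r X \<le> r Z"
      using that X(1) False by (intro X(2)) auto
    ultimately show ?thesis by (simp add: r_def[of Z] pos_le_divide_eq)
  qed simp
  have growth: "card (X + (\<Sum>i<k. B)) \<le> r X ^ k * card X" for k
  proof (induction k)
    case (Suc k)
    have "finite (\<Sum>i<k. B)" by (induction k) (use fin in \<open>auto intro: finite_set_plus\<close>)
    then have "card (X + B + (\<Sum>i<k. B)) \<le> r X * card (X + (\<Sum>i<k. B))"
      by (intro Petridis finX fin eq minimal r0)
    also have "\<dots> \<le> r X * (r X ^ k * card X)"
      using Suc r0 by (intro mult_left_mono)
    finally show ?case by (simp add: add_ac mult_ac)
  qed simp
  have "r X \<le> r A" using ne by (intro X(2)) auto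
  then have "r X ^ k * card X \<le> (card (A + B) / card A) ^ k * card X" for k
    using r0 unfolding r_def[of A] by (intro mult_right_mono power_mono) auto
  then show thesis
    using growth X(1) by (intro that[of X]) (auto intro: order_trans)
qed

text \<open>
  Fix a representation \<open>v = b - c\<close> for each difference \<open>v\<close>. Then \<open>(x, v) \<mapsto> (x + b, x + c)\<close> is
  injective, since the difference of the two coordinates gives back \<open>v\<close>.
\<close>
lemma Ruzsa_triangle:
  fixes X B C :: "'a::ab_group_add set"
  assumes "finite X" "finite B" "finite C"
  shows "card X * card (B + uminus ` C) \<le> card (X + B) * card (X + C)"
proof -
  have "\<forall>v \<in> B + uminus ` C. \<exists>p. fst p \<in> B \<and> snd p \<in> C \<and> v = fst p - snd p"
    by (fastforce simp: set_plus_def)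
  then obtain f where
    f: "\<And>v. v \<in> B + uminus ` C \<Longrightarrow> fst (f v) \<in> B \<and> snd (f v) \<in> C \<and> v = fst (f v) - snd (f v)"
    by metis
  let ?g = "\<lambda>(x, v). (x + fst (f v), x + snd (f v))"
  have "inj_on ?g (X \<times> (B + uminus ` C))"
  proof (rule inj_onI, clarify)
    fix x v x' v'
    assume v: "v \<in> B + uminus ` C" "v' \<in> B + uminus ` C"
      and eq: "x + fst (f v) = x' + fst (f v')" "x + snd (f v) = x' + snd (f v')"
    have "v = (x + fst (f v)) - (x + snd (f v))"
      using f[OF v(1)] by simp
    also have "\<dots> = v'"
      using f[OF v(2)] by (simp add: eq)
    finally show "x = x' \<and> v = v'" using eq by simp
  qed
  moreover have "?g ` (X \<times> (B + uminus ` C)) \<subseteq> (X + B) \<times> (X + C)"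
    using f by auto
  ultimately have "card (X \<times> (B + uminus ` C)) \<le> card ((X + B) \<times> (X + C))"
    using assms by (intro card_inj_on_le[of ?g]) (auto intro: finite_set_plus)
  then show ?thesis by (simp add: card_cartesian_product)
qed

lemma Pluennecke_Ruzsa:
  fixes A B :: "'a::ab_group_add set"
  assumes fin: "finite A" "finite B" and ne: "A \<noteq> {}"
  shows "card ((\<Sum>i<k. B) + uminus ` (\<Sum>i<l. B)) \<le> (card (A + B) / card A) ^ (k + l) * card A"
proof -
  let ?K = "card (A + B) / card A"
  obtain X where X: "X \<subseteq> A" "X \<noteq> {}" "\<And>k. card (X + (\<Sum>i<k. B)) \<le> ?K ^ k * card X"
    using Pluennecke[OF fin ne] by metis
  have finX: "finite X" using X fin(1) finite_subset by blast
  then have posX: "real (card X) > 0" using X by (simp add: card_gt_0_iff)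
  have finB: "finite (\<Sum>i<k. B)" for k :: nat
    by (induction k) (use fin in \<open>auto intro: finite_set_plus\<close>)
  let ?D = "(\<Sum>i<k. B) + uminus ` (\<Sum>i<l. B)"
  have "real (card X) * card ?D \<le> real (card (X + (\<Sum>i<k. B))) * card (X + (\<Sum>i<l. B))"
    using Ruzsa_triangle[OF finX finB finB] by (metis of_nat_mono of_nat_mult)
  also have "\<dots> \<le> (?K ^ k * card X) * (?K ^ l * card X)"
    by (intro mult_mono X(3)) auto
  also have "\<dots> = card X * (?K ^ (k + l) * card X)"
    by (simp add: power_add)
  finally have "card ?D \<le> ?K ^ (k + l) * card X"
    using posX by (simp only: mult_le_cancel_left_pos)
  also have "\<dots> \<le> ?K ^ (k + l) * card A"
    using card_mono[OF fin(1) X(1)] by (intro mult_left_mono) auto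
  finally show ?thesis .
qed

section \<open>Values of many lines on a common set\<close>

text \<open>All such \<open>t\<close> lie in the interval ending at the largest of them.\<close>
lemma card_close_above_le:
  fixes S :: "'a::linorder set" and g :: real
  assumes "finite S" "g \<ge> 0"
  shows "card {t \<in> S. s < t \<and> card (S \<inter> {s<..t}) \<le> g} \<le> g"
proof (cases "{t \<in> S. s < t \<and> card (S \<inter> {s<..t}) \<le> g} = {}")
  case False
  let ?W = "{t \<in> S. s < t \<and> card (S \<inter> {s<..t}) \<le> g}"
  have finW: "finite ?W" using assms by auto
  have "Max ?W \<in> ?W" using Max_in[OF finW False] .
  moreover have "?W \<subseteq> S \<inter> {s<..Max ?W}"
    using Max_ge[OF finW] by auto
  then have "card ?W \<le> card (S \<inter> {s<..Max ?W})"
    using assms by (intro card_mono) auto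
  ultimately show ?thesis
    by (metis (mono_tags, lifting) mem_Collect_eq of_nat_mono order_trans)
next
  case True
  then show ?thesis using assms(2) by (simp only: card.empty of_nat_0)
qed

text \<open>
  Consider the lines \<open>t \<mapsto> u + x t\<close> on pairs of consecutive elements of \<open>Y\<close>. The intervals between
  the two values are disjoint for a fixed line, so for at least half of the pairs the interval
  contains at most \<open>g = 2 |S| / (|Y| - 1)\<close> elements of \<open>S\<close>. On the other hand the pair and the two
  values determine the line, and each pair of consecutive elements of \<open>Y\<close> admits only \<open>|S| g\<close> pairs
  of values that are so close in \<open>S\<close>. Comparing the two counts gives the bound.
\<close>
lemma card_sum_prod_lower_bound:
  fixes U X Y S :: "'a::linordered_idom set"
  assumes fin: "finite U" "finite X" "finite Y" "finite S"
    and pos: "\<And>x. x \<in> X \<Longrightarrow> x > 0"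
    and S: "\<And>u x y. u \<in> U \<Longrightarrow> x \<in> X \<Longrightarrow> y \<in> Y \<Longrightarrow> u + x * y \<in> S"
  shows "card U * card X * (card Y - 1) \<le> 4 * (card S)\<^sup>2"
proof (cases "card Y \<le> 1")
  case False
  define Y0 where "Y0 = Y - {Max Y}"
  define m where "m = card Y0"
  have "Y \<noteq> {}" using False by auto
  then have m: "m = card Y - 1"
    using fin by (simp add: m_def Y0_def)
  have m0: "m > 0" using m False by simp
  have finY0: "finite Y0" using fin by (simp add: Y0_def)
  define nx where "nx y = Min {t \<in> Y. y < t}" for y
  have nx: "nx y \<in> Y" "y < nx y" "\<And>t. t \<in> Y \<Longrightarrow> y < t \<Longrightarrow> nx y \<le> t" if "y \<in> Y0" for y
  proof -
    have "y \<le> Max Y" "Max Y \<in> Y" "y \<noteq> Max Y"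
      using that fin \<open>Y \<noteq> {}\<close> by (auto simp: Y0_def)
    then have ne: "{t \<in> Y. y < t} \<noteq> {}" by force
    have "Min {t \<in> Y. y < t} \<in> {t \<in> Y. y < t}"
      by (rule Min_in) (use fin ne in auto)
    then show "nx y \<in> Y" "y < nx y" by (auto simp: nx_def)
    show "nx y \<le> t" if "t \<in> Y" "y < t" for t
      unfolding nx_def by (rule Min_le) (use fin that in auto)
  qed
  have Y0Y: "y \<in> Y" if "y \<in> Y0" for y using that by (simp add: Y0_def)
  define g :: real where "g = 2 * card S / m"
  define J where "J u x y = S \<inter> {u + x * y<..u + x * nx y}" for u x y
  define G where "G u x = {y \<in> Y0. card (J u x y) \<le> g}" for u x
  have half: "real m / 2 \<le> card (G u x)" if "u \<in> U" "x \<in> X" for u x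
  proof -
    let ?bad = "Y0 - G u x"
    have x0: "x > 0" using pos that by auto
    have disj: "J u x y \<inter> J u x y' = {}" if "y \<in> Y0" "y' \<in> Y0" "y < y'" for y y'
    proof -
      have "x * nx y \<le> x * y'"
        using nx(3)[OF that(1) Y0Y[OF that(2)] that(3)] x0 by simp
      then show ?thesis by (auto simp: J_def)
    qed
    have "(\<Sum>y\<in>Y0. card (J u x y)) = card (\<Union>y\<in>Y0. J u x y)"
    proof (rule card_UN_disjoint[symmetric])
      show "\<forall>i\<in>Y0. \<forall>j\<in>Y0. i \<noteq> j \<longrightarrow> J u x i \<inter> J u x j = {}"
      proof (intro ballI impI)
        fix i j assume "i \<in> Y0" "j \<in> Y0" "i \<noteq> j"
        then show "J u x i \<inter> J u x j = {}"
          using disj[of i j] disj[of j i] by (cases "i < j") auto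
      qed
    qed (use finY0 fin in \<open>auto simp: J_def\<close>)
    also have "\<dots> \<le> card S"
      using fin by (intro card_mono) (auto simp: J_def)
    finally have total: "(\<Sum>y\<in>Y0. real (card (J u x y))) \<le> card S"
      by (metis of_nat_mono of_nat_sum)
    have "card ?bad * g = (\<Sum>y\<in>?bad. g)" by simp
    also have "\<dots> \<le> (\<Sum>y\<in>?bad. real (card (J u x y)))"
      by (intro sum_mono) (auto simp: G_def)
    also have "\<dots> \<le> (\<Sum>y\<in>Y0. real (card (J u x y)))"
      using finY0 by (intro sum_mono2) auto
    finally have "card ?bad * g \<le> card S" using total by linarith
    moreover have "u + x * Max Y \<in> S"
      using S that fin \<open>Y \<noteq> {}\<close> by auto
    then have "card S > 0" using fin by (auto simp: card_gt_0_iff)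
    ultimately have "card ?bad \<le> real m / 2"
      using m0 by (simp add: g_def field_simps)
    moreover have "card ?bad = m - card (G u x)" "card (G u x) \<le> m"
      unfolding m_def using finY0
      by (auto intro!: card_Diff_subset card_mono simp: G_def)
    ultimately show ?thesis by linarith
  qed
  define close where "close s = {t \<in> S. s < t \<and> card (S \<inter> {s<..t}) \<le> g}" for s
  have close: "card (close s) \<le> g" for s
    unfolding close_def by (rule card_close_above_le) (use fin in \<open>auto simp: g_def\<close>)
  let ?I = "Sigma (U \<times> X) (\<lambda>(u, x). G u x)"
  let ?O = "Y0 \<times> Sigma S close"
  let ?f = "\<lambda>((u, x), y). (y, u + x * y, u + x * nx y)"
  have "inj_on ?f ?I"
  proof (rule inj_onI)
    fix p p' assume "p \<in> ?I" "p' \<in> ?I" "?f p = ?f p'"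
    moreover obtain u x y where p: "p = ((u, x), y)" by (metis surj_pair)
    moreover obtain u' x' y' where p': "p' = ((u', x'), y')" by (metis surj_pair)
    ultimately have y: "y \<in> G u x" "y' = y"
      and eq: "u + x * y = u' + x' * y" "u + x * nx y = u' + x' * nx y"
      by auto
    have "x * (nx y - y) = (u + x * nx y) - (u + x * y)" by (simp add: algebra_simps)
    also have "\<dots> = x' * (nx y - y)" unfolding eq by (simp add: algebra_simps)
    finally have "x = x'" using y nx(2)[of y] by (auto simp: G_def)
    with eq y p p' show "p = p'" by simp
  qed
  moreover have "?f ` ?I \<subseteq> ?O"
  proof (rule image_subsetI)
    fix p assume "p \<in> ?I"
    moreover obtain u x y where p: "p = ((u, x), y)" by (metis surj_pair)
    ultimately have uxy: "u \<in> U" "x \<in> X" "y \<in> G u x" by auto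
    then have y: "y \<in> Y0" "card (J u x y) \<le> g" by (auto simp: G_def)
    then have "u + x * nx y \<in> close (u + x * y)"
      using uxy nx[OF y(1)] pos[of x] S by (auto simp: close_def J_def)
    then show "?f p \<in> ?O"
      using uxy y S Y0Y by (auto simp: p)
  qed
  moreover have "finite ?O"
    using fin finY0 by (intro finite_cartesian_product finite_SigmaI) (auto simp: close_def)
  ultimately have "card ?I \<le> card ?O" by (rule card_inj_on_le)
  also have "card ?O = m * (\<Sum>s\<in>S. card (close s))"
    using fin by (simp add: m_def card_cartesian_product card_SigmaI close_def)
  finally have count: "real (card ?I) \<le> m * (\<Sum>s\<in>S. real (card (close s)))"
    by (metis of_nat_mono of_nat_mult of_nat_sum)
  have "card U * card X * (m / 2) = (\<Sum>p\<in>U \<times> X. real m / 2)"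
    by (simp add: card_cartesian_product)
  also have "\<dots> \<le> (\<Sum>p\<in>U \<times> X. real (card (case p of (u, x) \<Rightarrow> G u x)))"
    by (intro sum_mono) (use half in auto)
  also have "\<dots> = card ?I"
    using fin finY0 by (subst card_SigmaI) (auto simp: G_def)
  also have "\<dots> \<le> m * (\<Sum>s\<in>S. g)"
    by (rule order_trans[OF count]) (intro mult_left_mono sum_mono close, simp)
  also have "\<dots> = 2 * (real (card S))\<^sup>2"
    using m0 by (simp add: g_def power2_eq_square)
  finally have "real (card U * card X * m) \<le> real (4 * (card S)\<^sup>2)" by simp
  then show ?thesis unfolding m by (simp only: of_nat_le_iff)
qed simp

section \<open>Distances between Cartesian products\<close>

lemma finite_diff_set: "finite A \<Longrightarrow> finite B \<Longrightarrow> finite (diff_set A B)"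
proof -
  assume "finite A" "finite B"
  moreover have "diff_set A B = (\<lambda>(x, y). x - y) ` (A \<times> B)"
    by (auto simp: diff_set_def)
  ultimately show ?thesis by simp
qed

text \<open>By symmetry, half of the nonzero differences are positive.\<close>
lemma card_diff_set_self:
  assumes "finite A"
  shows "card (diff_set A A) \<le> 2 * card {x \<in> diff_set A A. x > 0} + 1"
proof -
  let ?P = "{x \<in> diff_set A A. x > 0}"
  have fin: "finite ?P" using finite_diff_set[OF assms assms] by simp
  have "- x \<in> diff_set A A" if "x \<in> diff_set A A" for x
    using that unfolding diff_set_def by force
  then have "diff_set A A \<subseteq> insert 0 (?P \<union> uminus ` ?P)"
    by (force simp: image_iff intro: bexI[of _ "- _"])
  then have "card (diff_set A A) \<le> card (insert 0 (?P \<union> uminus ` ?P))"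
    using fin by (intro card_mono) auto
  also have "\<dots> \<le> Suc (card ?P + card (uminus ` ?P))"
    using card_insert_le_m1 card_Un_le fin
    by (metis (no_types, lifting) card_insert_if finite_Un finite_imageI le_SucI le_Suc_eq not_less_eq_eq)
  finally show ?thesis by (simp add: card_image)
qed

lemma card_le_2_card_squares:
  fixes D :: "'a::linordered_idom set"
  assumes "finite D"
  shows "card D \<le> 2 * card ((\<lambda>d. d\<^sup>2) ` D)"
proof -
  let ?Q = "(\<lambda>d. d\<^sup>2) ` D"
  have "D \<subseteq> (abs ` D) \<union> uminus ` (abs ` D)"
  proof
    fix d assume "d \<in> D"
    moreover have "d = \<bar>d\<bar> \<or> d = - \<bar>d\<bar>" by (simp add: abs_if)
    ultimately show "d \<in> (abs ` D) \<union> uminus ` (abs ` D)" by blast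
  qed
  then have "card D \<le> card ((abs ` D) \<union> uminus ` (abs ` D))"
    using assms by (intro card_mono) auto
  also have "\<dots> \<le> card (abs ` D) + card (uminus ` (abs ` D))" by (rule card_Un_le)
  also have "\<dots> = 2 * card (abs ` D)" by (simp add: card_image)
  also have "card (abs ` D) = card ((\<lambda>d. d\<^sup>2) ` (abs ` D))"
    by (rule card_image[symmetric]) (auto simp: inj_on_def power2_eq_iff)
  also have "(\<lambda>d. d\<^sup>2) ` (abs ` D) = ?Q" by (simp add: image_image)
  finally show ?thesis .
qed

lemma dist_set_Times:
  "dist_set (A \<times> A) (B \<times> B) = (\<lambda>d. d\<^sup>2) ` diff_set A B + (\<lambda>d. d\<^sup>2) ` diff_set A B"
  unfolding dist_set_def diff_set_def set_plus_def by blast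

text \<open>
  The bound with exponent \<open>10/11\<close>, in integer form: the lower bound for \<open>q + 2 x y\<close> and the
  Pluennecke--Ruzsa upper bound, both for \<open>S = 3Q - 2Q\<close>. They read \<open>|Q| N\<^sup>2 \<le> 32 |S|\<^sup>2\<close> and
  \<open>|S| |Q|\<^sup>4 \<le> |\<Delta>|\<^sup>5\<close>, so that \<open>|Q|\<^sup>9 N\<^sup>2 \<le> 2\<^sup>5 |\<Delta>|\<^sup>1\<^sup>0\<close>, and \<open>N \<le> 2 |Q|\<close> costs a further
  factor \<open>2\<^sup>9\<close>.
\<close>
lemma Min_diff_set_power_le:
  assumes fin: "finite A" "finite B" and card: "card A \<ge> 2" "card B \<ge> 2"
  defines "N \<equiv> Min {card (diff_set A A), card (diff_set B B), card (diff_set A B)}"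
  shows "real N ^ 11 \<le> 2 ^ 14 * real (card (dist_set (A \<times> A) (B \<times> B))) ^ 10"
proof -
  let ?P = "{x \<in> diff_set A A. x > 0}"
  define Q where "Q = (\<lambda>d. d\<^sup>2) ` diff_set A B"
  define S where "S = (\<Sum>i<3::nat. Q) + uminus ` (\<Sum>i<2::nat. Q)"
  define T where "T = card (dist_set (A \<times> A) (B \<times> B))"
  have T: "T = card (Q + Q)" by (simp add: T_def dist_set_Times Q_def)
  have finQ: "finite Q" using fin by (simp add: Q_def finite_diff_set)
  have S': "S = Q + Q + Q + uminus ` (Q + Q)"
    by (simp add: S_def numeral_eq_Suc)
  have finS: "finite S" using finQ by (auto simp: S' intro!: finite_set_plus)
  have N: "N \<le> card (diff_set A A)" "N \<le> card (diff_set B B)" "N \<le> card (diff_set A B)"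
    by (simp_all add: N_def)
  have QN: "N \<le> 2 * card Q"
    using card_le_2_card_squares[OF finite_diff_set[OF fin]] N unfolding Q_def by simp
  have "A \<noteq> {}" "B \<noteq> {}" using card by auto
  then obtain a b where ab: "a \<in> A" "b \<in> B" by blast
  then have "(a - b)\<^sup>2 \<in> Q" by (auto simp: Q_def diff_set_def)
  then have Q0: "Q \<noteq> {}" "card Q > 0" using finQ by (auto simp: card_gt_0_iff)
  have two: "card (diff_set A A) \<ge> 2" if "finite A" "card A \<ge> 2" for A :: "real set"
  proof -
    have "A \<noteq> {}" using that by auto
    then obtain a where a: "a \<in> A" by blast
    have "(\<lambda>x. x - a) ` A \<subseteq> diff_set A A" using a by (auto simp: diff_set_def)
    then have "card ((\<lambda>x. x - a) ` A) \<le> card (diff_set A A)"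
      using that by (intro card_mono finite_diff_set)
    then show ?thesis using that by (simp add: card_image inj_on_def)
  qed
  \<comment> \<open>The factor \<open>2\<close> of \<open>2 x y\<close> is absorbed into the set of slopes.\<close>
  have "card Q * card ((\<lambda>x. 2 * x) ` ?P) * (card (diff_set B B) - 1) \<le> 4 * (card S)\<^sup>2"
  proof (rule card_sum_prod_lower_bound)
    fix q x y
    assume q: "q \<in> Q" and x: "x \<in> (\<lambda>x. 2 * x) ` ?P" and y: "y \<in> diff_set B B"
    obtain a a' b b' where
      ab: "a \<in> A" "a' \<in> A" "b \<in> B" "b' \<in> B" "x = 2 * (a - a')" "y = b - b'"
      using x y by (auto simp: diff_set_def)
    have in_Q: "(a - b)\<^sup>2 \<in> Q" if "a \<in> A" "b \<in> B" for a b
      using that by (auto simp: Q_def diff_set_def)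
    have qxy: "q + x * y = q + (a - b')\<^sup>2 + (a' - b)\<^sup>2 + - ((a - b)\<^sup>2 + (a' - b')\<^sup>2)"
      unfolding ab by (simp add: power2_eq_square algebra_simps)
    show "q + x * y \<in> S"
      unfolding S' qxy by (intro set_plus_intro imageI in_Q q ab(1-4))
  qed (use fin finQ finS in \<open>auto simp: finite_diff_set\<close>)
  then have low: "card Q * card ?P * (card (diff_set B B) - 1) \<le> 4 * (card S)\<^sup>2"
    by (simp add: card_image inj_on_def)
  have "N \<le> 4 * card ?P"
    using card_diff_set_self[OF fin(1)] two[OF fin(1) card(1)] N by linarith
  moreover have "N \<le> 2 * (card (diff_set B B) - 1)"
    using two[OF fin(2) card(2)] N by linarith
  ultimately have "card Q * (N * N) \<le> card Q * ((4 * card ?P) * (2 * (card (diff_set B B) - 1)))"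
    by (intro mult_left_mono mult_mono) auto
  also have "\<dots> = 8 * (card Q * card ?P * (card (diff_set B B) - 1))" by simp
  also have "\<dots> \<le> 32 * (card S)\<^sup>2" using low by linarith
  finally have lower: "real (card Q) * (real N)\<^sup>2 \<le> 32 * (real (card S))\<^sup>2"
    unfolding power2_eq_square by (metis of_nat_mono of_nat_mult of_nat_numeral)
  have "card S \<le> (real T / card Q) ^ (3 + 2) * card Q"
    unfolding S_def T by (rule Pluennecke_Ruzsa) (use finQ Q0 in auto)
  also have "\<dots> = real T ^ 5 / real (card Q) ^ 4"
    using Q0 by (simp add: field_simps power_divide eval_nat_numeral)
  finally have upper: "real (card S) * real (card Q) ^ 4 \<le> real T ^ 5"
    using Q0 by (simp add: field_simps)
  have "real N ^ 11 = real N ^ 9 * (real N)\<^sup>2" by (simp flip: power_add)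
  also have "\<dots> \<le> (2 * real (card Q)) ^ 9 * (real N)\<^sup>2"
    using QN by (intro mult_right_mono power_mono) auto
  also have "\<dots> = 2 ^ 9 * real (card Q) ^ 8 * (real (card Q) * (real N)\<^sup>2)"
    by (simp add: power_mult_distrib eval_nat_numeral)
  also have "\<dots> \<le> 2 ^ 9 * real (card Q) ^ 8 * (32 * (real (card S))\<^sup>2)"
    using lower by (intro mult_left_mono) auto
  also have "\<dots> = 2 ^ 14 * (real (card S) * real (card Q) ^ 4)\<^sup>2"
    by (simp add: power_mult_distrib flip: power_mult)
  also have "\<dots> \<le> 2 ^ 14 * (real T ^ 5)\<^sup>2"
    using upper by (intro mult_left_mono power_mono) auto
  also have "\<dots> = 2 ^ 14 * real T ^ 10" by (simp flip: power_mult)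
  finally show ?thesis unfolding T_def .
qed

lemma L_factor_ge_half:
  assumes "card A \<ge> 2" "card B \<ge> 2"
  shows "L_factor A B \<ge> 1 / 2"
proof -
  have "1 / 2 \<le> ln (real n) powr (3 / 205)" if "n \<ge> 2" for n :: nat
  proof -
    have "1 / 2 \<le> ln (2::real)" using ln_le_minus_one[of "1 / 2"] by (simp add: ln_div)
    also have "\<dots> \<le> ln (real n)" using that by simp
    finally have ln: "1 / 2 \<le> ln (real n)" .
    have "1 / 2 = (1 / 2 :: real) powr 1" by simp
    also have "\<dots> \<le> (1 / 2) powr (3 / 205)" by (rule powr_mono') auto
    also have "\<dots> \<le> ln (real n) powr (3 / 205)" using ln by (intro powr_mono2) auto
    finally show ?thesis .
  qed
  then show ?thesis using assms by (simp add: L_factor_def)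
qed

theorem theorem3:
  "\<exists>C::real. C > 0 \<and>
     (\<forall>A B :: real set. finite A \<longrightarrow> finite B \<longrightarrow> card A \<ge> 2 \<longrightarrow> card B \<ge> 2 \<longrightarrow>
        real (Min {card (diff_set A A), card (diff_set B B), card (diff_set A B)})
          \<le> C * (real (card (dist_set (A \<times> A) (B \<times> B))) powr (1 - 13 / 205) * L_factor A B))"
  \<comment> \<open>\<open>8 = 4 \<cdot> 2\<close>: the root \<open>2\<^bsup>14/11\<^esup>\<close> is at most \<open>4\<close>, and \<open>L_factor\<close> is at least \<open>1/2\<close>.\<close>
proof (rule exI[of _ 8], intro conjI allI impI)
  fix A B :: "real set"
  assume fin: "finite A" "finite B" and card: "card A \<ge> 2" "card B \<ge> 2"
  define N where "N = real (Min {card (diff_set A A), card (diff_set B B), card (diff_set A B)})"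
  define T where "T = card (dist_set (A \<times> A) (B \<times> B))"
  have le: "N ^ 11 \<le> 2 ^ 14 * real T ^ 10"
    unfolding N_def T_def by (rule Min_diff_set_power_le[OF fin card])
  have "N \<le> 4 * real T powr (10 / 11)"
  proof (cases "T = 0")
    case True
    then show ?thesis using le by (simp add: power_le_zero_eq)
  next
    case False
    have "N ^ 11 \<le> 4 ^ 11 * real T ^ 10"
      by (rule order_trans[OF le]) (intro mult_right_mono, auto)
    also have "real T ^ 10 = (real T powr (10 / 11)) ^ 11"
      using False by (simp add: powr_power)
    also have "4 ^ 11 * \<dots> = (4 * real T powr (10 / 11)) ^ 11"
      by (rule power_mult_distrib[symmetric])
    finally show ?thesis by (subst (asm) power_mono_iff) (auto simp: N_def)
  qed
  also have "real T powr (10 / 11) \<le> real T powr (1 - 13 / 205)"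
    by (cases "T = 0") (auto intro: powr_mono)
  also have "4 * real T powr (1 - 13 / 205) \<le> 8 * (real T powr (1 - 13 / 205) * L_factor A B)"
    using mult_left_mono[OF L_factor_ge_half[OF card], of "8 * real T powr (1 - 13 / 205)"]
    by (simp add: mult_ac)
  finally show "N \<le> 8 * (real T powr (1 - 13 / 205) * L_factor A B)" by simp
qed simp

end
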